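(* Let $H$ be a sparse semigroup of genus $g$ with gaps $\ell_1<\dots<\ell_g$, and let $\kappa:=2g-\ell_g$, where $\kappa>1$. If $g\ge 2\kappa-1$, then $\ell_{i+1}-\ell_i=2$ for every $i=2\kappa-2,\dots,g-1$.
   Context: $\mathbb{N}$ is the set of natural numbers including $0$. A numerical semigroup $H\subseteq\mathbb{N}$ of genus $g\ge 1$ is a subset containing $0$, closed under addition, whose complement $\mathbb{N}\setminus H=\{1=\ell_1<\ell_2<\dots<\ell_g\}$ has exactly $g$ elements. Elements of the complement are called gaps and $\ell_g$ is the Frobenius number. $H$ is sparse if $\ell_i-\ell_{i-1}\le 2$ for all $i=2,\dots,g$. *)

theory Defs
  imports Main
begin

definition numerical_semigroup :: "nat set \<Rightarrow> bool" where
  "numerical_semigroup H \<longleftrightarrow>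
     0 \<in> H \<and> (\<forall>x\<in>H. \<forall>y\<in>H. x + y \<in> H) \<and> finite (- H)"

definition genus :: "nat set \<Rightarrow> nat" where
  "genus H = card (- H)"

text \<open>
  The gaps are indexed from 1: for \<open>1 \<le> i \<le> genus H\<close>, \<open>gap H i\<close> is the \<open>i\<close>-th smallest
  element of the complement of \<open>H\<close>; other indices carry no meaning.
\<close>

definition gap :: "nat set \<Rightarrow> nat \<Rightarrow> nat" where
  "gap H i = sorted_list_of_set (- H) ! (i - 1)"

definition sparse :: "nat set \<Rightarrow> bool" where
  "sparse H \<longleftrightarrow> (\<forall>i\<in>{2..genus H}. int (gap H i) - int (gap H (i - 1)) \<le> 2)"

end

theory Submission imports Defs begin

text \<open>
  Call a gap \<open>a\<close> \<^emph>\<open>single\<close> if \<open>a + 1\<close> is also a gap. In a sparse semigroup every positive nongap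
  below the Frobenius number directly follows a gap, so there are exactly \<open>\<kappa> - 1\<close> single
  gaps. If \<open>a\<close> is single and \<open>h < a\<close> is a positive nongap, then \<open>a - h\<close> is single as well; hence
  below \<open>a\<close> there are at least as many single gaps as positive nongaps, thus at least as many as
  nonsingle gaps. If \<open>a\<close> is the \<open>i\<close>-th gap, this gives \<open>i - 1 \<le> 2 (\<kappa> - 2)\<close>.
\<close>

lemma nth_less_nth_iff:
  fixes xs :: "'a::linorder list"
  assumes "sorted_wrt (<) xs" "i < length xs" "j < length xs"
  shows "xs ! i < xs ! j \<longleftrightarrow> i < j"
  using assms by (metis linorder_neqE_nat order_less_asym sorted_wrt_nth_less)

text \<open>In a strictly increasing list, the entries smaller than the one at position
  \<open>i\<close> are exactly those at positions 0 to \<open>i - 1\<close>, and they are distinct.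
  This turns the index of a gap into a count of smaller gaps.\<close>

lemma card_less_nth_sorted_list_of_set:
  fixes A :: "'a::linorder set"
  assumes "finite A" "i < card A"
  shows "card {x\<in>A. x < sorted_list_of_set A ! i} = i"
proof -
  let ?xs = "sorted_list_of_set A"
  have srt: "sorted_wrt (<) ?xs" and len: "length ?xs = card A" and set: "set ?xs = A"
    using assms by simp_all
  have "{x\<in>A. x < ?xs ! i} = (!) ?xs ` {..<i}"
  proof (intro equalityI subsetI)
    fix x assume x: "x \<in> {x\<in>A. x < ?xs ! i}"
    then obtain j where j: "j < card A" "x = ?xs ! j"
      using set len by (metis (no_types, lifting) in_set_conv_nth mem_Collect_eq)
    then show "x \<in> (!) ?xs ` {..<i}"
      using x nth_less_nth_iff[OF srt] assms(2) len by auto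
  next
    fix x assume "x \<in> (!) ?xs ` {..<i}"
    then obtain j where j: "j < i" "x = ?xs ! j" by auto
    then have "x \<in> A" using set len assms(2) by (metis nth_mem order_less_trans)
    then show "x \<in> {x\<in>A. x < ?xs ! i}"
      using j nth_less_nth_iff[OF srt] assms(2) len by auto
  qed
  moreover have "inj_on ((!) ?xs) {..<i}"
    using assms by (auto simp: inj_on_def nth_eq_iff_index_eq)
  ultimately show ?thesis by (simp add: card_image)
qed

lemma gap_notin:
  assumes "numerical_semigroup H" "1 \<le> i" "i \<le> genus H"
  shows "gap H i \<notin> H"
proof -
  have "gap H i \<in> set (sorted_list_of_set (- H))"
    unfolding gap_def using assms by (intro nth_mem) (auto simp: genus_def)
  then show ?thesis using assms by (simp add: numerical_semigroup_def)
qed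

lemma gap_less_gap_iff:
  assumes "1 \<le> i" "i \<le> genus H" "1 \<le> j" "j \<le> genus H"
  shows "gap H i < gap H j \<longleftrightarrow> i < j"
  using assms nth_less_nth_iff[of "sorted_list_of_set (- H)" "i - 1" "j - 1"]
  by (auto simp: gap_def genus_def)

lemma card_gaps_less_gap:
  assumes "numerical_semigroup H" "1 \<le> i" "i \<le> genus H"
  shows "card {x. x \<notin> H \<and> x < gap H i} = i - 1"
  using card_less_nth_sorted_list_of_set[of "- H" "i - 1"] assms
  by (simp add: gap_def genus_def numerical_semigroup_def)

lemma obtain_gap_index:
  assumes "numerical_semigroup H" "x \<notin> H"
  obtains i where "1 \<le> i" "i \<le> genus H" "gap H i = x"
proof -
  have "x \<in> set (sorted_list_of_set (- H))"
    using assms by (simp add: numerical_semigroup_def)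
  then obtain j where "j < card (- H)" "sorted_list_of_set (- H) ! j = x"
    by (auto simp: in_set_conv_nth)
  then show ?thesis using that[of "j + 1"] by (simp add: gap_def genus_def)
qed

lemma le_last_gap:
  assumes "numerical_semigroup H" "x \<notin> H"
  shows "x \<le> gap H (genus H)"
proof -
  obtain i where "1 \<le> i" "i \<le> genus H" "gap H i = x"
    using obtain_gap_index[OF assms] .
  then show ?thesis using gap_less_gap_iff[of "genus H" H i] by force
qed

lemma one_notin:
  assumes "numerical_semigroup H" "1 \<le> genus H"
  shows "1 \<notin> H"
proof
  assume "1 \<in> H"
  have "n \<in> H" for n
    using assms(1) \<open>1 \<in> H\<close>
    by (induction n) (auto simp: numerical_semigroup_def simp flip: Suc_eq_plus1)
  then show False using gap_notin[OF assms(1) order_refl assms(2)] by blast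
qed

text \<open>If \<open>h - 1\<close> and \<open>h\<close> were both nongaps, they would lie strictly
  between two neighbouring gaps, which would then be at least 3 apart.\<close>

lemma sparse_nongap_pred_notin:
  assumes H: "numerical_semigroup H" and "sparse H" and g: "1 \<le> genus H"
    and h: "h \<in> H" "0 < h" "h < gap H (genus H)"
  shows "h - 1 \<notin> H"
proof
  assume h1: "h - 1 \<in> H"
  \<comment> \<open>\<open>n\<close> will be the index of the first gap beyond \<open>h\<close>, so
    the gaps with indices \<open>n - 1\<close> and \<open>n\<close> enclose
    \<open>h\<close>.\<close>
  define I where "I = {i. 1 \<le> i \<and> i \<le> genus H \<and> h < gap H i}"
  define n where "n = (LEAST i. i \<in> I)"
  have "genus H \<in> I" using g h by (simp add: I_def)
  then have n: "n \<in> I" unfolding n_def by (rule LeastI)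
  \<comment> \<open>The gap 1 lies below \<open>gap H n\<close>, so \<open>n\<close> is not the
    first index and \<open>gap H (n - 1)\<close> is a genuine gap.\<close>
  obtain k where k: "1 \<le> k" "k \<le> genus H" "gap H k = 1"
    using obtain_gap_index[OF H one_notin[OF H g]] .
  have "h \<noteq> 1" using h one_notin[OF H g] by auto
  then have "gap H k < gap H n" using k n h by (auto simp: I_def)
  then have "2 \<le> n" using k n gap_less_gap_iff[of k H n] by (auto simp: I_def)
  moreover have "n - 1 \<notin> I" using not_less_Least[of "n - 1" "\<lambda>i. i \<in> I"] \<open>2 \<le> n\<close> n_def by simp
  ultimately have pred: "1 \<le> n - 1" "n - 1 \<le> genus H" "gap H (n - 1) \<le> h"
    using n by (auto simp: I_def)
  have "gap H (n - 1) \<notin> H" using gap_notin[OF H pred(1,2)] .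
  then have "gap H (n - 1) \<noteq> h" "gap H (n - 1) \<noteq> h - 1" using h h1 by auto
  then have "gap H (n - 1) + 2 \<le> h" using pred(3) by linarith
  moreover have "h < gap H n" using n by (simp add: I_def)
  moreover have "int (gap H n) - int (gap H (n - 1)) \<le> 2"
    using \<open>sparse H\<close> \<open>2 \<le> n\<close> n by (simp add: sparse_def I_def)
  ultimately show False by linarith
qed

definition single_gaps :: "nat set \<Rightarrow> nat set" where
  "single_gaps H = {x. x \<notin> H \<and> x + 1 \<notin> H}"

lemma finite_single_gaps: "numerical_semigroup H \<Longrightarrow> finite (single_gaps H)"
  by (rule finite_subset[of _ "- H"]) (auto simp: single_gaps_def numerical_semigroup_def)

text \<open>With L the Frobenius number, the interval from 1 to L consists of the gaps and the
  nongaps in \<open>N\<close>, so \<open>N\<close> has L - \<open>genus H\<close> elements. Their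
  predecessors are gaps that are not single, and these together with the single gaps fit into the
  \<open>genus H - 1\<close> gaps other than L.\<close>

lemma sparse_card_single_gaps:
  assumes H: "numerical_semigroup H" and "sparse H" and g: "1 \<le> genus H"
  shows "card (single_gaps H) + gap H (genus H) + 1 \<le> 2 * genus H"
proof -
  let ?L = "gap H (genus H)"
  define N where "N = {h\<in>H. 0 < h \<and> h < ?L}"
  have fin: "finite (- H)" and "0 \<in> H" using H by (auto simp: numerical_semigroup_def)
  have L: "?L \<notin> H" using gap_notin[OF H g order_refl] .
  have "- H \<subseteq> {1..?L}"
    using le_last_gap[OF H] \<open>0 \<in> H\<close> by (auto simp: Suc_le_eq intro: gr0I)
  then have "{1..?L} = - H \<union> N" using L by (auto simp: N_def le_less)
  moreover have "- H \<inter> N = {}" "finite N" by (auto simp: N_def)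
  ultimately have "card {1..?L} = genus H + card N"
    using card_Un_disjoint[OF fin, of N] by (simp only: genus_def)
  then have cardN: "?L = genus H + card N" by simp
  have "inj_on (\<lambda>h. h - 1) N" by (auto simp: inj_on_def N_def)
  then have cardN': "card ((\<lambda>h. h - 1) ` N) = card N" by (rule card_image)
  \<comment> \<open>L is neither single, since L + 1 exceeds the largest gap, nor the predecessor of
    an element of \<open>N\<close>.\<close>
  have "single_gaps H \<union> (\<lambda>h. h - 1) ` N \<subseteq> - H - {?L}"
    using sparse_nongap_pred_notin[OF H \<open>sparse H\<close> g] le_last_gap[OF H]
    by (fastforce simp: single_gaps_def N_def)
  then have "card (single_gaps H \<union> (\<lambda>h. h - 1) ` N) \<le> card (- H - {?L})"
    using fin by (intro card_mono) auto
  moreover have "single_gaps H \<inter> (\<lambda>h. h - 1) ` N = {}"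
    by (auto simp: single_gaps_def N_def)
  ultimately have "card (single_gaps H) + card N \<le> genus H - 1"
    using fin L \<open>finite N\<close> cardN' finite_single_gaps[OF H]
    by (simp add: card_Un_disjoint genus_def)
  then show ?thesis using cardN g by linarith
qed

text \<open>If \<open>x\<close> is a nonsingle gap below \<open>a\<close>, then h =
  \<open>x + 1\<close> is a nongap, and neither \<open>a\<close> - h nor \<open>a\<close> - h + 1
  lies in \<open>H\<close>: adding h would put \<open>a\<close> or \<open>a + 1\<close> into
  \<open>H\<close>. So reflection maps the nonsingle gaps below \<open>a\<close> injectively into
  the single ones.\<close>

lemma card_gaps_less_single_gap:
  assumes H: "numerical_semigroup H" and a: "a \<in> single_gaps H"
  shows "card {x. x \<notin> H \<and> x < a} \<le> 2 * card {x\<in>single_gaps H. x < a}"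
proof -
  let ?S = "{x\<in>single_gaps H. x < a}"
  let ?D = "{x. x \<notin> H \<and> x + 1 \<in> H \<and> x < a}"
  have closed: "\<And>x y. x \<in> H \<Longrightarrow> y \<in> H \<Longrightarrow> x + y \<in> H"
    using H by (simp add: numerical_semigroup_def)
  have "(\<lambda>x. a - (x + 1)) ` ?D \<subseteq> ?S"
  proof (intro image_subsetI)
    fix x assume x: "x \<in> ?D"
    \<comment> \<open>Since \<open>x + 1\<close> is a nongap and \<open>a\<close> is a gap,
      \<open>x + 1 < a\<close>, and the truncated subtraction is exact.\<close>
    then have "x + 1 \<noteq> a" using a by (auto simp: single_gaps_def)
    then have eq: "a = (a - (x + 1)) + (x + 1)" "a + 1 = (a - (x + 1) + 1) + (x + 1)"
      using x by auto
    have "a - (x + 1) \<notin> H" "a - (x + 1) + 1 \<notin> H"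
      using closed[of _ "x + 1"] x a eq by (auto simp only: single_gaps_def mem_Collect_eq) metis+
    then show "a - (x + 1) \<in> ?S" using x by (auto simp: single_gaps_def)
  qed
  moreover have "inj_on (\<lambda>x. a - (x + 1)) ?D"
    by (auto simp: inj_on_def)
  ultimately have "card ?D \<le> card ?S" by (auto intro: card_inj_on_le)
  moreover have "{x. x \<notin> H \<and> x < a} = ?S \<union> ?D" by (auto simp: single_gaps_def)
  ultimately show ?thesis using card_Un_le[of ?S ?D] by simp
qed

theorem proposition2p2:
  fixes H :: "nat set" and g :: nat and \<kappa> :: int
  assumes "numerical_semigroup H"
    and "genus H = g" and "g \<ge> 1"
    and "sparse H"
    and "\<kappa> = 2 * int g - int (gap H g)" and "\<kappa> > 1"
    and "int g \<ge> 2 * \<kappa> - 1"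
  shows "\<forall>i::nat. 2 * \<kappa> - 2 \<le> int i \<and> int i \<le> int g - 1 \<longrightarrow>
           int (gap H (i + 1)) - int (gap H i) = 2"
proof (intro allI impI)
  fix i :: nat assume i: "2 * \<kappa> - 2 \<le> int i \<and> int i \<le> int g - 1"
  then have i1: "1 \<le> i" "i \<le> genus H" "i + 1 \<le> genus H" using assms by auto
  let ?a = "gap H i"
  have "?a < gap H (i + 1)" using i1 gap_less_gap_iff[of i H "i + 1"] by simp
  moreover have "int (gap H (i + 1)) - int ?a \<le> 2"
    using \<open>sparse H\<close> i1 unfolding sparse_def by (auto dest!: bspec[of _ _ "i + 1"])
  moreover have "gap H (i + 1) \<noteq> ?a + 1"
  proof
    assume "gap H (i + 1) = ?a + 1"
    then have a: "?a \<in> single_gaps H"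
      using gap_notin[OF assms(1), of i] gap_notin[OF assms(1), of "i + 1"] i1
      by (simp add: single_gaps_def)
    \<comment> \<open>The inequality is strict because \<open>a\<close> itself is single; at most
      \<kappa> - 2 single gaps thus lie below it. Doubling gives \<open>i\<close> \<le> 2\<kappa> -
      3, against the choice of \<open>i\<close>.\<close>
    have "card {x\<in>single_gaps H. x < ?a} < card (single_gaps H)"
      using a finite_single_gaps[OF assms(1)] by (intro psubset_card_mono) auto
    moreover have "i - 1 \<le> 2 * card {x\<in>single_gaps H. x < ?a}"
      using card_gaps_less_single_gap[OF assms(1) a] card_gaps_less_gap[OF assms(1) i1(1,2)]
      by simp
    moreover have "int (card (single_gaps H)) + 1 \<le> \<kappa>"
      using sparse_card_single_gaps[OF assms(1,4)] assms(2,3,5) by simp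
    ultimately show False using i i1 by linarith
  qed
  ultimately show "int (gap H (i + 1)) - int ?a = 2" by linarith
qed

end
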